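(* Let $p$ be a prime. There exists a family $\mathcal{C}$ of subsets of $\mathbb{Z}_p$ with $$|\mathcal{C}| \le \exp\big( 2^{12} (\log p)^2 \big),$$ such that for each $n \in \mathbb{N}$ and every $v \in \mathbb{Z}_p^n$ with $\rho(v) \ge 4/p$ and $|v| \ge 2^{18} \log p$, there exist sets $B(v) \in \mathcal{C}$ and $Y = Y(v) \subset [n]$ with $n/4 \le |Y| \le n/2$, such that $$\big| \{ i \in [n] : v_i \notin B(v) \} \big| \le \frac{n}{4} \qquad \text{and} \qquad |B(v)| \le \frac{2^{16}}{\rho(v_Y)\sqrt{|v|}}.$$
   Context: $\log$ denotes the natural logarithm. For a vector $v \in \mathbb{Z}_p^n$, $|v| := |\{ i \in [n] : v_i \ne 0\}|$ is the size of its support, and $$\rho(v) := \max_{a \in \mathbb{Z}_p} \Pr\Big( \sum_{i=1}^n u_i v_i = a \Big),$$ where $u$ is uniformly distributed on $\{-1,1\}^n$. For $Y \subset [n]$, $v_Y \in \mathbb{Z}_p^{|Y|}$ denotes the restriction of $v$ to the coordinates in $Y$ (and $\rho(v_Y)$ is defined in the same way for this shorter vector). Note the family $\mathcal{C}$ depends only on $p$, not on $n$. *)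

theory Defs
  imports Complex_Main "HOL-Library.FuncSet" "HOL-Computational_Algebra.Primes"
begin

text \<open>Z_p is represented by the integers {0..<p}; a vector v in Z_p^n by a function
  v :: nat => int with v i in {0..<p} for i < n (values at i >= n are irrelevant).
  The coordinates [n] are {0..<n}.\<close>

definition supp_size :: "nat \<Rightarrow> (nat \<Rightarrow> int) \<Rightarrow> nat" where
  "supp_size n v = card {i \<in> {0..<n}. v i \<noteq> 0}"

definition rho :: "nat \<Rightarrow> (nat \<Rightarrow> int) \<Rightarrow> nat set \<Rightarrow> real" where
  "rho p v I = Max ((\<lambda>a. real (card {u \<in> I \<rightarrow>\<^sub>E {-1, 1::int}.
        (\<Sum>i\<in>I. u i * v i) mod int p = a}) / 2 ^ card I) ` {0..<int p})"

end

theory Submission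
  imports Defs "HOL-Analysis.L2_Norm"
begin

text \<open>
  Write $F_I(k) = \sum_{i \in I} \sin^2(2 \pi k v_i / p)$. Fourier inversion gives
  $p\, \rho(v_Y) \le \sum_k e^{-F_Y(k)/2}$. Since $\sqrt{F_Y}$ is subadditive, the $j$-fold sumset
  of the level set $\{F_Y \le t\}$ lies in $\{F_Y \le j^2 t\}$, so the Cauchy--Davenport theorem bounds
  $p\, \rho(v_Y)$ by $O(|T| / \sqrt{|v|})$ for $T = \{F_Y \le M\}$ with $M$ of order $|v|$ (Halasz).
  A random half $Y$ of the coordinates ensures that $F_{[n]}$ is $O(|v|)$ on all of $T$.

  The containers are the sets of residues $x$ for which the average of $\sin^2(2 \pi k x / p)$ over the
  entries $k$ of a tuple of $O(\log p)$ residues is at most $1/16$. If the tuple is drawn from $T$, almost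
  every $v_i$ lies in its container by the bound on $F_{[n]}$. By a Chernoff bound some such tuple has a
  container consisting only of $x$ whose average over the whole of $T$ is at most $1/4$, and Parseval's
  identity shows that there are at most $4 p / |T|$ of these.
\<close>

section \<open>Sumsets modulo a prime\<close>

definition sumset_mod :: "int \<Rightarrow> int set \<Rightarrow> int set \<Rightarrow> int set" where
  "sumset_mod p A B = (\<lambda>(a, b). (a + b) mod p) ` (A \<times> B)"

lemma sumset_modI: "a \<in> A \<Longrightarrow> b \<in> B \<Longrightarrow> (a + b) mod p \<in> sumset_mod p A B"
  by (force simp: sumset_mod_def)

lemma sumset_modE:
  assumes "x \<in> sumset_mod p A B"
  obtains a b where "a \<in> A" "b \<in> B" "x = (a + b) mod p"
  using assms by (auto simp: sumset_mod_def)

lemma finite_sumset_mod: "finite A \<Longrightarrow> finite B \<Longrightarrow> finite (sumset_mod p A B)"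
  by (simp add: sumset_mod_def)

text \<open>Modulo a prime a nonzero \<open>b\<close> is invertible, so the translates
  \<open>a + k b\<close> with \<open>k < p\<close> are distinct; all lie in \<open>A\<close>, which
  therefore has \<open>p\<close> elements.\<close>

lemma translation_invariant_eq_UNIV_mod:
  fixes p :: nat
  assumes p: "prime p" and A: "A \<subseteq> {0..<int p}" "A \<noteq> {}"
    and b: "b \<in> {0..<int p}" "b \<noteq> 0" and inv: "\<And>a. a \<in> A \<Longrightarrow> (a + b) mod int p \<in> A"
  shows "A = {0..<int p}"
proof -
  obtain a where a: "a \<in> A" using A by auto
  have p0: "p > 0" using p prime_gt_0_nat by blast
  have mem: "(a + int k * b) mod int p \<in> A" for k
  proof (induction k)
    case 0
    show ?case using a A by (auto simp: subset_iff)
  next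
    case (Suc k)
    have "((a + int k * b) mod int p + b) mod int p = (a + int (Suc k) * b) mod int p"
      by (simp add: mod_simps algebra_simps)
    with inv[OF Suc] show ?case by simp
  qed
  have inj: "inj_on (\<lambda>k. (a + int k * b) mod int p) {..<p}"
  proof (rule inj_onI)
    fix k l assume kl: "k \<in> {..<p}" "l \<in> {..<p}"
      and "(a + int k * b) mod int p = (a + int l * b) mod int p"
    then have "int p dvd (int k - int l) * b"
      by (simp add: mod_eq_dvd_iff algebra_simps)
    moreover have "\<not> int p dvd b" using b by (auto dest: zdvd_imp_le)
    ultimately have "int p dvd int k - int l"
      using p by (simp add: prime_dvd_mult_iff)
    then have "int k mod int p = int l mod int p"
      by (simp only: mod_eq_dvd_iff)
    then show "k = l" using kl by (metis lessThan_iff mod_less of_nat_eq_iff zmod_int)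
  qed
  have "p \<le> card A"
    using card_inj_on_le[OF inj, of A] mem finite_subset[OF A(1)] by auto
  then show ?thesis using A(1)
    by (intro card_subset_eq) (auto intro!: antisym card_mono[of "{0..<int p}" A, simplified])
qed

text \<open>Strong induction on the size of \<open>B\<close>, shrinking \<open>B\<close> by a Dyson
  transform. The normalisation \<open>0 \<in> B\<close> gives \<open>A \<subseteq> A + B\<close> and
  survives the transform.\<close>

theorem cauchy_davenport:
  fixes p :: nat
  assumes p: "prime p"
  shows "A \<subseteq> {0..<int p} \<Longrightarrow> A \<noteq> {} \<Longrightarrow> B \<subseteq> {0..<int p} \<Longrightarrow> 0 \<in> B \<Longrightarrow>
    min p (card A + card B - 1) \<le> card (sumset_mod (int p) A B)"
proof (induction "card B" arbitrary: A B rule: less_induct)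
  case less
  have finA: "finite A" and finB: "finite B"
    using less.prems finite_subset[OF _ finite_atLeastLessThan_int] by blast+
  have p0: "p > 0" using p prime_gt_0_nat by blast
  have sub: "A \<subseteq> sumset_mod (int p) A B"
  proof
    fix a assume a: "a \<in> A"
    then have "a = (a + 0) mod int p" using less.prems(1) by auto
    then show "a \<in> sumset_mod (int p) A B" using sumset_modI[OF a less.prems(4)] by metis
  qed
  have A_le: "card A \<le> card (sumset_mod (int p) A B)"
    by (rule card_mono[OF finite_sumset_mod[OF finA finB] sub])
  consider "B = {0}" | "A = {0..<int p}" | "A \<noteq> {0..<int p}" "\<exists>b\<in>B. b \<noteq> 0"
    using less.prems(4) by blast
  then show ?case
  proof cases
    case 1
    then show ?thesis using A_le by simp
  next
    case 2
    then show ?thesis using A_le by simp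
  next
    case 3
    then obtain b where b: "b \<in> B" "b \<noteq> 0" by blast
    \<comment> \<open>\<open>A\<close> is nonempty and proper, so translation by \<open>b\<close>
      cannot preserve it.\<close>
    obtain a where a: "a \<in> A" "(a + b) mod int p \<notin> A"
      using translation_invariant_eq_UNIV_mod[OF p less.prems(1,2), of b] b 3(1) less.prems(3) by blast
    \<comment> \<open>Elements of \<open>a + B\<close> missing from \<open>A\<close> are added to
      \<open>A\<close>, and the corresponding elements are dropped from \<open>B\<close>. The total
      size is kept, the sumset does not grow, and \<open>b\<close> leaves \<open>B\<close> while
      \<open>0\<close> stays because \<open>a \<in> A\<close>.\<close>
    define \<tau> where "\<tau> x = (a + x) mod int p" for x
    define A' where "A' = A \<union> \<tau> ` B"
    define B' where "B' = {x \<in> B. \<tau> x \<in> A}"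
    have \<tau>_inj: "inj_on \<tau> B"
    proof (rule inj_onI)
      fix x y assume xy: "x \<in> B" "y \<in> B" "\<tau> x = \<tau> y"
      have "x mod int p = y mod int p"
        using xy(3) unfolding \<tau>_def by (simp add: mod_eq_dvd_iff)
      with xy less.prems(3) show "x = y" by (auto simp: subset_iff)
    qed
    have B'_psub: "B' \<subset> B" using b a by (auto simp: B'_def \<tau>_def)
    have B'_lt: "card B' < card B" by (rule psubset_card_mono[OF finB B'_psub])
    have "a mod int p = a" using a less.prems(1) by auto
    then have 0: "0 \<in> B'" using less.prems(4) a by (simp add: B'_def \<tau>_def)
    have "A \<inter> \<tau> ` B = \<tau> ` B'" by (auto simp: B'_def)
    then have "card A' + card B' = card A + card B"
      using card_Un_Int[OF finA finite_imageI[OF finB, of \<tau>]] card_image[OF \<tau>_inj]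
        card_image[OF inj_on_subset[OF \<tau>_inj, of B']] B'_psub
      by (simp add: A'_def)
    moreover have "sumset_mod (int p) A' B' \<subseteq> sumset_mod (int p) A B"
    proof
      fix x assume "x \<in> sumset_mod (int p) A' B'"
      then obtain c d where cd: "c \<in> A'" "d \<in> B'" "x = (c + d) mod int p" by (rule sumset_modE)
      show "x \<in> sumset_mod (int p) A B"
      proof (cases "c \<in> A")
        case True
        with cd show ?thesis by (auto simp: B'_def intro: sumset_modI)
      next
        case False
        with cd obtain e where e: "e \<in> B" "c = \<tau> e" by (auto simp: A'_def)
        \<comment> \<open>The shift by \<open>a\<close> moves from \<open>e\<close> to
          \<open>d\<close>, and \<open>\<tau> d\<close> lies in \<open>A\<close> by the choice of
          \<open>B'\<close>.\<close>
        have "x = (\<tau> d + e) mod int p"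
          using cd(3) e by (simp add: \<tau>_def mod_simps algebra_simps)
        with cd(2) e show ?thesis by (auto simp: B'_def intro: sumset_modI)
      qed
    qed
    then have "card (sumset_mod (int p) A' B') \<le> card (sumset_mod (int p) A B)"
      by (intro card_mono finite_sumset_mod finA finB)
    moreover have "min p (card A' + card B' - 1) \<le> card (sumset_mod (int p) A' B')"
      using less.prems p0 B'_psub 0
      by (intro less.hyps[OF B'_lt]) (auto simp: A'_def \<tau>_def)
    ultimately show ?thesis by simp
  qed
qed

fun iterated_sumset :: "int \<Rightarrow> int set \<Rightarrow> nat \<Rightarrow> int set" where
  "iterated_sumset p A 0 = {0}"
| "iterated_sumset p A (Suc j) = sumset_mod p (iterated_sumset p A j) A"

lemma iterated_sumset_subset:
  assumes "p > 0" shows "iterated_sumset p A j \<subseteq> {0..<p}"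
  using assms by (cases j) (auto elim!: sumset_modE)

text \<open>Each application of Cauchy-Davenport adds \<open>card A - 1\<close> elements until the
  whole group is reached.\<close>

lemma card_iterated_sumset:
  fixes p :: nat
  assumes p: "prime p" and A: "A \<subseteq> {0..<int p}" "0 \<in> A"
  shows "min p (j * (card A - 1) + 1) \<le> card (iterated_sumset (int p) A j)"
proof (induction j)
  case 0
  show ?case by simp
next
  case (Suc j)
  have p0: "p > 0" using p prime_gt_0_nat by blast
  let ?S = "iterated_sumset (int p) A j"
  have sub: "?S \<subseteq> {0..<int p}" using p0 by (intro iterated_sumset_subset) simp
  have "card ?S \<noteq> 0" using Suc p0 by linarith
  then have "?S \<noteq> {}" by auto
  from cauchy_davenport[OF p sub this A]
  have "min p (card ?S + card A - 1) \<le> card (iterated_sumset (int p) A (Suc j))" by simp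
  moreover have "card A \<ge> 1"
    using A finite_subset[OF A(1)] by (simp add: Suc_le_eq card_gt_0_iff) blast
  ultimately show ?case using Suc by (auto simp: min_def algebra_simps split: if_splits)
qed

section \<open>Fourier analysis of signed sums\<close>

text \<open>Orthogonality of additive characters: the terms are powers of a \<open>p\<close>-th root
  of unity, whose geometric sum vanishes unless the root is 1.\<close>

lemma sum_cis_roots:
  fixes p :: nat and y :: int
  assumes p: "p > 0"
  shows "(\<Sum>k\<in>{0..<int p}. cis (2 * pi * of_int (k * y) / p)) = (if int p dvd y then of_nat p else 0)"
proof -
  define z where "z = cis (2 * pi * of_int y / p)"
  have "(\<Sum>k\<in>{0..<int p}. cis (2 * pi * of_int (k * y) / p)) = (\<Sum>k<p. z ^ k)"
    by (rule sum.reindex_bij_witness[of _ int nat]) (auto simp: z_def DeMoivre mult_ac)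
  also have "\<dots> = (if int p dvd y then of_nat p else 0)"
  proof (cases "int p dvd y")
    case True
    then obtain l where "y = int p * l" by auto
    then have "2 * pi * of_int y / p = 2 * pi * of_int l" using p by simp
    then have "z = 1" by (simp add: z_def)
    with True show ?thesis by simp
  next
    case False
    have "z \<noteq> 1"
    proof
      assume "z = 1"
      then have "cos (2 * pi * of_int y / p) = 1" by (simp add: z_def complex_eq_iff)
      then obtain l :: int where "2 * pi * of_int y / p = of_int l * 2 * pi"
        by (auto simp: cos_one_2pi_int)
      then have "real_of_int y = of_int (l * int p)" using p by (simp add: field_simps)
      then have "y = l * int p" by linarith
      with False show False by simp
    qed
    moreover have "z ^ p = 1"
      using p by (simp add: z_def DeMoivre)
    ultimately show ?thesis using False by (simp add: geometric_sum)
  qed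
  finally show ?thesis .
qed

section \<open>Weights and energies of frequencies\<close>

definition wt :: "nat \<Rightarrow> int \<Rightarrow> int \<Rightarrow> real" where
  "wt p k x = (sin (2 * pi * of_int (k * x) / p))\<^sup>2"

text \<open>The function F_I of the introduction. It controls the Fourier coefficient of the signed
  sum at frequency \<open>k\<close>, since each cosine factor is at most
  \<open>exp (- wt / 2)\<close> in modulus.\<close>

definition energy :: "nat \<Rightarrow> (nat \<Rightarrow> int) \<Rightarrow> nat set \<Rightarrow> int \<Rightarrow> real" where
  "energy p v I k = (\<Sum>i\<in>I. wt p k (v i))"

lemma wt_nonneg: "0 \<le> wt p k x" by (simp add: wt_def)

lemma wt_le_1: "wt p k x \<le> 1" by (simp add: wt_def abs_square_le_1)

lemma wt_zero [simp]: "wt p 0 x = 0" "wt p k 0 = 0" by (simp_all add: wt_def)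

lemma energy_nonneg: "0 \<le> energy p v I k"
  by (simp add: energy_def sum_nonneg wt_nonneg)

lemma energy_zero [simp]: "energy p v I 0 = 0" by (simp add: energy_def)

lemma wt_mod: "p > 0 \<Longrightarrow> wt p (k mod int p) x = wt p k x"
proof -
  assume p: "p > 0"
  have "k * x = (k mod int p) * x + int p * ((k div int p) * x)"
    by (metis mod_mult_div_eq distrib_right mult.assoc)
  then have "of_int (k * x) = (of_int ((k mod int p) * x) :: real) + real p * of_int ((k div int p) * x)"
    by (metis of_int_add of_int_mult of_int_of_nat_eq)
  then have "2 * pi * of_int (k * x) / p =
      2 * pi * of_int ((k mod int p) * x) / p + 2 * pi * of_int ((k div int p) * x)"
    using p by (simp add: field_simps)
  then show ?thesis by (simp add: wt_def sin_add del: of_int_mult)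
qed

lemma energy_mod: "p > 0 \<Longrightarrow> energy p v I (k mod int p) = energy p v I k"
  by (simp add: energy_def wt_mod)

lemma abs_sin_add_le: "\<bar>sin (x + y)\<bar> \<le> \<bar>sin x\<bar> + \<bar>sin (y::real)\<bar>"
proof -
  have "\<bar>sin (x + y)\<bar> \<le> \<bar>sin x\<bar> * \<bar>cos y\<bar> + \<bar>cos x\<bar> * \<bar>sin y\<bar>"
    unfolding sin_add by (metis abs_mult abs_triangle_ineq)
  also have "\<dots> \<le> \<bar>sin x\<bar> * 1 + 1 * \<bar>sin y\<bar>"
    by (intro add_mono mult_mono) auto
  finally show ?thesis by simp
qed

text \<open>The root of the energy is the Euclidean norm of the vector of absolute sines. These are
  subadditive in the angle, so Minkowski's inequality applies.\<close>

lemma sqrt_energy_add_le: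
  "sqrt (energy p v I (k + l)) \<le> sqrt (energy p v I k) + sqrt (energy p v I l)"
proof -
  define s where "s k i = \<bar>sin (2 * pi * of_int (k * v i) / p)\<bar>" for k i
  have E: "sqrt (energy p v I k) = L2_set (s k) I" for k
    by (simp add: L2_set_def energy_def wt_def s_def)
  have "L2_set (s (k + l)) I \<le> L2_set (\<lambda>i. s k i + s l i) I"
  proof (rule L2_set_mono)
    fix i
    have "2 * pi * of_int ((k + l) * v i) / p = 2 * pi * of_int (k * v i) / p + 2 * pi * of_int (l * v i) / p"
      by (simp add: algebra_simps add_divide_distrib)
    then show "s (k + l) i \<le> s k i + s l i"
      unfolding s_def by (metis abs_sin_add_le)
  qed (simp add: s_def)
  also have "\<dots> \<le> L2_set (s k) I + L2_set (s l) I" by (rule L2_set_triangle_ineq)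
  finally show ?thesis by (simp add: E)
qed

lemma abs_cos_le_exp: "\<bar>cos x\<bar> \<le> exp (- (sin x)\<^sup>2 / 2)" for x :: real
proof (rule power2_le_imp_le)
  have "\<bar>cos x\<bar>\<^sup>2 = 1 + - (sin x)\<^sup>2" by (simp add: cos_squared_eq)
  also have "\<dots> \<le> exp (- (sin x)\<^sup>2)" by (rule exp_ge_add_one_self)
  also have "\<dots> = (exp (- (sin x)\<^sup>2 / 2))\<^sup>2" by (simp flip: exp_double)
  finally show "\<bar>cos x\<bar>\<^sup>2 \<le> (exp (- (sin x)\<^sup>2 / 2))\<^sup>2" .
qed simp

lemma cis_sum: "finite I \<Longrightarrow> cis (\<Sum>i\<in>I. f i) = (\<Prod>i\<in>I. cis (f i))"
  by (induction I rule: finite_induct) (simp_all flip: cis_mult)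

section \<open>Concentration probabilities and Fourier inversion\<close>

lemma rho_attained:
  assumes "p > 0"
  obtains a where "a \<in> {0..<int p}"
    "rho p v I = real (card {u \<in> I \<rightarrow>\<^sub>E {-1, 1::int}. (\<Sum>i\<in>I. u i * v i) mod int p = a}) / 2 ^ card I"
proof -
  have "rho p v I \<in> (\<lambda>a. real (card {u \<in> I \<rightarrow>\<^sub>E {-1, 1::int}.
        (\<Sum>i\<in>I. u i * v i) mod int p = a}) / 2 ^ card I) ` {0..<int p}"
    unfolding rho_def using assms by (intro Max_in) auto
  then show ?thesis using that by auto
qed

lemma card_le_rho:
  assumes "p > 0"
  shows "real (card {u \<in> I \<rightarrow>\<^sub>E {-1, 1::int}. (\<Sum>i\<in>I. u i * v i) mod int p = b mod int p})
    \<le> rho p v I * 2 ^ card I"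
proof -
  have "real (card {u \<in> I \<rightarrow>\<^sub>E {-1, 1::int}. (\<Sum>i\<in>I. u i * v i) mod int p = b mod int p}) / 2 ^ card I
    \<le> rho p v I"
    unfolding rho_def using assms by (intro Max_ge) auto
  then show ?thesis by (simp add: divide_le_eq)
qed

lemma finite_sign_vectors: "finite I \<Longrightarrow> finite (I \<rightarrow>\<^sub>E {-1, 1::int})"
  by (rule finite_PiE) simp_all

lemma card_sign_vectors: "finite I \<Longrightarrow> card (I \<rightarrow>\<^sub>E {-1, 1::int}) = 2 ^ card I"
  by (simp add: card_PiE numeral_2_eq_2)

lemma rho_le_1:
  assumes "p > 0" "finite I" shows "rho p v I \<le> 1"
proof -
  obtain a where "a \<in> {0..<int p}" and a: "rho p v I = real (card {u \<in> I \<rightarrow>\<^sub>E {-1, 1::int}. (\<Sum>i\<in>I. u i * v i) mod int p = a}) / 2 ^ card I"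
    by (rule rho_attained[OF assms(1), of v I])
  have "card {u \<in> I \<rightarrow>\<^sub>E {-1, 1::int}. (\<Sum>i\<in>I. u i * v i) mod int p = a} \<le> 2 ^ card I"
    unfolding card_sign_vectors[OF assms(2), symmetric] by (rule card_mono[OF finite_sign_vectors[OF assms(2)] Collect_subset])
  from of_nat_mono[OF this, where 'a = real] show ?thesis
    unfolding a by (simp add: divide_le_eq)
qed

text \<open>Conditioning on the sign at \<open>i\<close> leaves a signed sum over \<open>I\<close>
  with a shifted target. Each of the two conditional probabilities is at most
  \<open>rho p v I\<close>, hence so is their average.\<close>

lemma rho_insert_le:
  assumes p: "p > 0" and I: "finite I" "i \<notin> I"
  shows "rho p v (insert i I) \<le> rho p v I"
proof -
  define S where "S b = {u \<in> I \<rightarrow>\<^sub>E {-1, 1::int}. (\<Sum>i\<in>I. u i * v i) mod int p = b mod int p}" for b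
  obtain a where a: "a \<in> {0..<int p}"
    "rho p v (insert i I) = real (card {u \<in> insert i I \<rightarrow>\<^sub>E {-1, 1::int}.
      (\<Sum>i\<in>insert i I. u i * v i) mod int p = a}) / 2 ^ card (insert i I)" (is "_ = real (card ?U) / _")
    by (rule rho_attained[OF p, of v "insert i I"])
  have fin: "finite (S b)" for b unfolding S_def using finite_sign_vectors[OF I(1)] by simp
  have "?U \<subseteq> (\<lambda>g. g(i := 1)) ` S (a - v i) \<union> (\<lambda>g. g(i := -1)) ` S (a + v i)"
  proof
    fix u assume u: "u \<in> ?U"
    then obtain y g where yg: "y \<in> {-1, 1}" "g \<in> I \<rightarrow>\<^sub>E {-1, 1}" "u = g(i := y)"
      unfolding PiE_insert_eq by auto
    have "(\<Sum>j\<in>I. u j * v j) = (\<Sum>j\<in>I. g j * v j)"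
      using I yg by (intro sum.cong) auto
    then have "(y * v i + (\<Sum>j\<in>I. g j * v j)) mod int p = a mod int p"
      using u I yg a(1) by auto
    then have "(\<Sum>j\<in>I. g j * v j) mod int p = (a - y * v i) mod int p"
      by (simp add: mod_eq_dvd_iff algebra_simps)
    then have "g \<in> S (a - y * v i)" using yg by (simp add: S_def)
    then show "u \<in> (\<lambda>g. g(i := 1)) ` S (a - v i) \<union> (\<lambda>g. g(i := -1)) ` S (a + v i)"
      using yg by auto
  qed
  then have "card ?U \<le> card ((\<lambda>g. g(i := 1)) ` S (a - v i) \<union> (\<lambda>g. g(i := -1)) ` S (a + v i))"
    using fin by (intro card_mono) auto
  also have "\<dots> \<le> card (S (a - v i)) + card (S (a + v i))"
    by (rule order.trans[OF card_Un_le]) (intro add_mono card_image_le fin)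
  finally have "real (card ?U) \<le> real (card (S (a - v i))) + real (card (S (a + v i)))" by linarith
  also have "\<dots> \<le> rho p v I * 2 ^ card I + rho p v I * 2 ^ card I"
    unfolding S_def by (intro add_mono card_le_rho p)
  finally show ?thesis unfolding a(2) using I by (simp add: divide_le_eq mult_ac)
qed

text \<open>Lets the lower bound on the concentration of the full vector pass to its restriction to
  a sampled half.\<close>

lemma rho_antimono:
  assumes p: "p > 0" and fin: "finite J" and sub: "I \<subseteq> J"
  shows "rho p v J \<le> rho p v I"
proof -
  have "rho p v (I \<union> D) \<le> rho p v I" if "finite D" for D
    using that
  proof (induction D rule: finite_induct)
    case (insert d D)
    show ?case
    proof (cases "d \<in> I \<union> D")
      case True
      then show ?thesis using insert.IH by (simp add: insert_absorb)
    next
      case False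
      have "rho p v (insert d (I \<union> D)) \<le> rho p v (I \<union> D)"
        using False insert.hyps finite_subset[OF sub fin] by (intro rho_insert_le[OF p]) auto
      then show ?thesis using insert.IH by simp
    qed
  qed simp
  from this[of J] fin sub show ?thesis by (simp add: Un_absorb1)
qed

text \<open>Character orthogonality counts the sign vectors hitting the most likely value
  \<open>a\<close>. At each frequency the sum over sign vectors is, up to a phase, a product of
  factors \<open>2 cos\<close>, and every cosine is bounded by an exponential.\<close>

lemma rho_le_sum_exp_energy:
  assumes p: "p > 0" and I: "finite I"
  shows "rho p v I * p \<le> (\<Sum>k\<in>{0..<int p}. exp (- energy p v I k / 2))"
proof -
  obtain a where a: "a \<in> {0..<int p}"
    "rho p v I = real (card {u \<in> I \<rightarrow>\<^sub>E {-1, 1::int}. (\<Sum>i\<in>I. u i * v i) mod int p = a}) / 2 ^ card I"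
    (is "_ = real (card ?U) / _")
    by (rule rho_attained[OF p, of v I])
  define P where "P = I \<rightarrow>\<^sub>E {-1, 1::int}"
  have finP: "finite P" unfolding P_def by (rule finite_sign_vectors[OF I])
  define c where "c u k = cis (2 * pi * of_int (k * ((\<Sum>i\<in>I. u i * v i) - a)) / p)" for u k
  have "(\<Sum>k\<in>{0..<int p}. \<Sum>u\<in>P. c u k) = (\<Sum>u\<in>P. \<Sum>k\<in>{0..<int p}. c u k)"
    by (rule sum.swap)
  also have "\<dots> = (\<Sum>u\<in>P. if u \<in> ?U then of_nat p else 0)"
    unfolding c_def sum_cis_roots[OF p] using a(1)
    by (intro sum.cong refl) (simp add: P_def flip: mod_eq_dvd_iff)
  also have "\<dots> = of_nat p * of_nat (card ?U)"
    using finP by (simp add: sum.If_cases P_def Int_def conj_ac cong: conj_cong)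
  finally have "real p * card ?U = cmod (\<Sum>k\<in>{0..<int p}. \<Sum>u\<in>P. c u k)"
    by (simp add: norm_mult)
  also have "\<dots> \<le> (\<Sum>k\<in>{0..<int p}. cmod (\<Sum>u\<in>P. c u k))" by (rule norm_sum)
  also have "\<dots> \<le> (\<Sum>k\<in>{0..<int p}. 2 ^ card I * exp (- energy p v I k / 2))"
  proof (rule sum_mono)
    fix k
    define e where "e i s = cis (2 * pi * of_int (k * (s * v i)) / p)" for i and s :: int
    \<comment> \<open>The target \<open>a\<close> contributes only a phase independent of
      \<open>u\<close>, which disappears in the norm.\<close>
    have "c u k = cis (- 2 * pi * of_int (k * a) / p) * (\<Prod>i\<in>I. e i (u i))" for u
    proof -
      have "2 * pi * of_int (k * ((\<Sum>i\<in>I. u i * v i) - a)) / p =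
        - 2 * pi * of_int (k * a) / p + (\<Sum>i\<in>I. 2 * pi * of_int (k * (u i * v i)) / p)"
        by (simp add: algebra_simps diff_divide_distrib sum_distrib_left sum_divide_distrib)
      then show ?thesis unfolding c_def e_def cis_sum[OF I, symmetric] by (simp only: cis_mult)
    qed
    then have "cmod (\<Sum>u\<in>P. c u k) = cmod (\<Sum>u\<in>P. \<Prod>i\<in>I. e i (u i))"
      by (simp add: norm_mult flip: sum_distrib_left)
    also have "(\<Sum>u\<in>P. \<Prod>i\<in>I. e i (u i)) = (\<Prod>i\<in>I. \<Sum>s\<in>{-1, 1}. e i s)"
      unfolding P_def by (rule prod_sum_PiE[OF I, symmetric]) simp
    also have "cmod \<dots> = (\<Prod>i\<in>I. cmod (\<Sum>s\<in>{-1, 1}. e i s))" by (rule prod_norm[symmetric])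
    also have "\<dots> \<le> (\<Prod>i\<in>I. 2 * exp (- wt p k (v i) / 2))"
    proof (rule prod_mono, safe)
      fix i
      have "(\<Sum>s\<in>{-1, 1}. e i s) = of_real (2 * cos (2 * pi * of_int (k * v i) / p))"
        by (simp add: e_def complex_eq_iff)
      then have "cmod (\<Sum>s\<in>{-1, 1}. e i s) = 2 * \<bar>cos (2 * pi * of_int (k * v i) / p)\<bar>"
        by (simp only: norm_of_real abs_mult)
      then show "cmod (\<Sum>s\<in>{-1, 1}. e i s) \<le> 2 * exp (- wt p k (v i) / 2)"
        using abs_cos_le_exp[of "2 * pi * of_int (k * v i) / p"] by (simp add: wt_def)
    qed simp
    also have "\<dots> = 2 ^ card I * exp (- energy p v I k / 2)"
      using I by (simp add: prod.distrib energy_def sum_negf sum_divide_distrib flip: exp_sum)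
    finally show "cmod (\<Sum>u\<in>P. c u k) \<le> 2 ^ card I * exp (- energy p v I k / 2)" .
  qed
  finally have "real p * card ?U \<le> 2 ^ card I * (\<Sum>k\<in>{0..<int p}. exp (- energy p v I k / 2))"
    by (simp add: sum_distrib_left)
  then show ?thesis unfolding a(2) by (simp add: field_simps)
qed

section \<open>Averages of weights and Parseval's identity\<close>

lemma cos_double_wt: "cos (2 * pi * of_int (k * (2 * x)) / p) = 1 - 2 * wt p k x"
proof -
  have "2 * pi * of_int (k * (2 * x)) / p = 2 * (2 * pi * of_int (k * x) / p)" by simp
  then show ?thesis unfolding wt_def by (simp only: cos_double_sin)
qed

lemma wt_commute: "wt p k x = wt p x k" by (simp add: wt_def mult.commute)

text \<open>Doubling the angle turns the weight into the real part of a character; as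
  \<open>p\<close> is odd, \<open>2 * x\<close> is nonzero modulo \<open>p\<close> and the character
  sums to 0.\<close>

lemma sum_wt:
  assumes p: "prime p" "p > 2" and x: "x \<in> {0..<int p}" "x \<noteq> 0"
  shows "(\<Sum>k\<in>{0..<int p}. wt p k x) = p / 2"
proof -
  have "\<not> int p dvd 2 * x"
    using p x by (auto simp: prime_dvd_mult_iff dest: zdvd_imp_le)
  then have "(\<Sum>k\<in>{0..<int p}. cis (2 * pi * of_int (k * (2 * x)) / p)) = 0"
    using sum_cis_roots[of p "2 * x"] p by simp
  then have "(\<Sum>k\<in>{0..<int p}. cos (2 * pi * of_int (k * (2 * x)) / p)) = 0"
    by (metis (no_types, lifting) Re_sum cis.sel(1) sum.cong zero_complex.sel(1))
  then show ?thesis unfolding cos_double_wt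
    by (simp add: sum_subtractf flip: sum_distrib_left)
qed

text \<open>The mean energy over all frequencies is exactly half the support size. This will show
  that a low level set is not the whole group.\<close>

lemma large_energy:
  assumes p: "prime p" "p > 2" and v: "\<And>i. i < n \<Longrightarrow> v i \<in> {0..<int p}"
  shows "\<exists>k\<in>{0..<int p}. supp_size n v / 2 \<le> energy p v {0..<n} k"
proof (rule ccontr)
  assume "\<not> ?thesis"
  then have "(\<Sum>k\<in>{0..<int p}. energy p v {0..<n} k) < (\<Sum>k\<in>{0..<int p}. supp_size n v / 2)"
    using p by (intro sum_strict_mono) (auto simp: not_le)
  moreover have "(\<Sum>k\<in>{0..<int p}. energy p v {0..<n} k) = (\<Sum>i\<in>{0..<n}. \<Sum>k\<in>{0..<int p}. wt p k (v i))"
    unfolding energy_def by (rule sum.swap)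
  moreover have "\<dots> = (\<Sum>i\<in>{0..<n}. if v i \<noteq> 0 then p / 2 else 0)"
    using p v by (intro sum.cong refl) (auto simp: sum_wt)
  moreover have "\<dots> = supp_size n v * (p / 2)"
    unfolding supp_size_def by (simp add: sum.If_cases Int_def)
  ultimately show False by simp
qed

text \<open>A low average weight at \<open>x\<close> forces the character sum of \<open>T\<close> at
  \<open>2 x\<close> to have modulus at least \<open>card T / 2\<close>. By Parseval the squared
  moduli sum to \<open>p * card T\<close>, so this happens for few \<open>x\<close>.\<close>

lemma few_low_average:
  assumes p: "prime p" "p > 2" and T: "T \<subseteq> {0..<int p}"
  shows "card {x \<in> {0..<int p}. (\<Sum>k\<in>T. wt p k x) \<le> card T / 4} * card T \<le> 4 * p"
    (is "card ?S * card T \<le> _")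
proof -
  have finT: "finite T" using T finite_subset by blast
  define z where "z x = (\<Sum>k\<in>T. cis (2 * pi * of_int (x * (2 * k)) / p))" for x
  have sq: "of_real ((cmod (z x))\<^sup>2) = (\<Sum>k\<in>T. \<Sum>l\<in>T. cis (2 * pi * of_int (x * (2 * (k - l))) / p))" for x
  proof -
    have "of_real ((cmod (z x))\<^sup>2) = z x * cnj (z x)" by (rule complex_norm_square)
    also have "\<dots> = (\<Sum>k\<in>T. \<Sum>l\<in>T. cis (2 * pi * of_int (x * (2 * k)) / p) * cis (- (2 * pi * of_int (x * (2 * l)) / p)))"
      unfolding z_def cnj_sum sum_product cis_cnj ..
    also have "\<dots> = (\<Sum>k\<in>T. \<Sum>l\<in>T. cis (2 * pi * of_int (x * (2 * (k - l))) / p))"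
      by (intro sum.cong refl) (simp add: cis_mult algebra_simps diff_divide_distrib)
    finally show ?thesis .
  qed
  have "complex_of_real (\<Sum>x\<in>{0..<int p}. (cmod (z x))\<^sup>2) =
    (\<Sum>x\<in>{0..<int p}. \<Sum>k\<in>T. \<Sum>l\<in>T. cis (2 * pi * of_int (x * (2 * (k - l))) / p))"
    unfolding of_real_sum sq ..
  also have "\<dots> = (\<Sum>k\<in>T. \<Sum>x\<in>{0..<int p}. \<Sum>l\<in>T. cis (2 * pi * of_int (x * (2 * (k - l))) / p))"
    by (rule sum.swap)
  also have "\<dots> = (\<Sum>k\<in>T. \<Sum>l\<in>T. \<Sum>x\<in>{0..<int p}. cis (2 * pi * of_int (x * (2 * (k - l))) / p))"
    by (intro sum.cong refl sum.swap)
  also have "\<dots> = (\<Sum>k\<in>T. \<Sum>l\<in>T. if k = l then of_nat p else 0)"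
  proof (intro sum.cong refl)
    fix k l assume kl: "k \<in> T" "l \<in> T"
    \<comment> \<open>The factor 2 can be cancelled because \<open>p\<close> is an odd
      prime.\<close>
    have "int p dvd 2 * (k - l) \<longleftrightarrow> int p dvd k - l"
      using p by (subst prime_dvd_mult_iff) (auto dest: zdvd_imp_le)
    also have "\<dots> \<longleftrightarrow> k mod int p = l mod int p" by (rule mod_eq_dvd_iff[symmetric])
    also have "\<dots> \<longleftrightarrow> k = l" using kl T by (auto simp: subset_iff)
    finally have "int p dvd 2 * (k - l) \<longleftrightarrow> k = l" .
    then show "(\<Sum>x\<in>{0..<int p}. cis (2 * pi * of_int (x * (2 * (k - l))) / p)) = (if k = l then of_nat p else 0)"
      using sum_cis_roots[of p "2 * (k - l)"] p by simp
  qed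
  also have "\<dots> = of_nat (card T * p)" using finT by simp
  finally have parseval: "(\<Sum>x\<in>{0..<int p}. (cmod (z x))\<^sup>2) = real (card T * p)"
    by (metis of_real_eq_iff of_real_of_nat_eq)
  have "real (card ?S) * (card T / 2)\<^sup>2 = (\<Sum>x\<in>?S. (card T / 2)\<^sup>2)" by simp
  also have "\<dots> \<le> (\<Sum>x\<in>?S. (cmod (z x))\<^sup>2)"
  proof (intro sum_mono power_mono)
    fix x assume "x \<in> ?S"
    then have "card T / 2 \<le> (\<Sum>k\<in>T. 1 - 2 * wt p k x)"
      by (simp add: sum_subtractf flip: sum_distrib_left)
    also have "\<dots> = Re (z x)"
      unfolding z_def Re_sum cis.sel cos_double_wt by (simp add: wt_commute)
    also have "\<dots> \<le> cmod (z x)" by (rule complex_Re_le_cmod)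
    finally show "card T / 2 \<le> cmod (z x)" .
  qed simp
  also have "\<dots> \<le> (\<Sum>x\<in>{0..<int p}. (cmod (z x))\<^sup>2)" by (intro sum_mono2) auto
  finally have "real (card ?S) * card T * card T \<le> 4 * p * card T"
    unfolding parseval by (simp add: power2_eq_square field_simps)
  then have "card ?S * card T * card T \<le> 4 * p * card T"
    by (metis (no_types, lifting) of_nat_le_iff of_nat_mult of_nat_numeral)
  then show ?thesis by (cases "card T = 0") auto
qed

section \<open>Level sets of the energy\<close>

definition low_energy :: "nat \<Rightarrow> (nat \<Rightarrow> int) \<Rightarrow> nat set \<Rightarrow> nat \<Rightarrow> int set" where
  "low_energy p v I t = {k \<in> {0..<int p}. energy p v I k \<le> t}"

lemma iterated_low_energy:
  assumes "p > 0" "k \<in> iterated_sumset (int p) (low_energy p v I t) j"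
  shows "sqrt (energy p v I k) \<le> j * sqrt t"
  using assms(2)
proof (induction j arbitrary: k)
  case (Suc j)
  then obtain a b where ab: "a \<in> iterated_sumset (int p) (low_energy p v I t) j"
    "b \<in> low_energy p v I t" "k = (a + b) mod int p"
    by (auto elim: sumset_modE)
  have "sqrt (energy p v I k) = sqrt (energy p v I (a + b))"
    unfolding ab(3) energy_mod[OF assms(1)] ..
  also have "\<dots> \<le> sqrt (energy p v I a) + sqrt (energy p v I b)" by (rule sqrt_energy_add_le)
  also have "\<dots> \<le> j * sqrt t + sqrt t"
    using Suc.IH[OF ab(1)] ab(2) by (intro add_mono) (auto simp: low_energy_def)
  finally show ?case by (simp add: algebra_simps)
qed simp

text \<open>Square roots of energies add up at most linearly, so the \<open>j\<close>-fold sumset of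
  level \<open>t\<close> stays within level \<open>j\<^sup>2 * t\<close>. Since level
  \<open>M\<close> is proper, the Cauchy-Davenport minimum is not \<open>p\<close>.\<close>

lemma low_energy_growth:
  assumes p: "prime p" and jt: "j\<^sup>2 * t \<le> M" and ne: "low_energy p v I M \<noteq> {0..<int p}"
  shows "j * (card (low_energy p v I t) - 1) + 1 \<le> card (low_energy p v I M)"
proof -
  let ?T = "low_energy p v I"
  have p0: "p > 0" using p prime_gt_0_nat by blast
  have sub: "?T t \<subseteq> {0..<int p}" for t by (auto simp: low_energy_def)
  have fin: "finite (?T t)" for t using finite_subset[OF sub] by blast
  have 0: "0 \<in> ?T t" using p0 by (simp add: low_energy_def)
  have "card (?T M) < card {0..<int p}"
    using ne sub[of M] by (intro psubset_card_mono) auto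
  then have lt: "card (?T M) < p" by simp
  have "iterated_sumset (int p) (?T t) j \<subseteq> ?T M"
  proof
    fix k assume k: "k \<in> iterated_sumset (int p) (?T t) j"
    have "sqrt (energy p v I k) \<le> j * sqrt t" by (rule iterated_low_energy[OF p0 k])
    then have "(sqrt (energy p v I k))\<^sup>2 \<le> (j * sqrt t)\<^sup>2"
      by (intro power_mono) (auto simp: energy_nonneg)
    then have "energy p v I k \<le> real (j\<^sup>2 * t)"
      by (simp add: energy_nonneg power_mult_distrib)
    also have "\<dots> \<le> M" using jt by (simp only: of_nat_le_iff)
    finally show "k \<in> ?T M"
      using k iterated_sumset_subset[of "int p" "?T t" j] p0 by (auto simp: low_energy_def)
  qed
  then have "card (iterated_sumset (int p) (?T t) j) \<le> card (?T M)" by (rule card_mono[OF fin])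
  with card_iterated_sumset[OF p sub 0, of j] lt show ?thesis by linarith
qed

text \<open>The infinite series has value \<open>1 / (1 - 2 / 3)^2 = 9\<close>; an exact formula for
  the partial sums makes the induction work.\<close>

lemma sum_arith_geometric_le: "(\<Sum>t\<in>{1..M}. real t * (2 / 3) ^ (t - 1)) \<le> 9"
proof -
  have "(\<Sum>t\<in>{1..M}. real t * (2 / 3) ^ (t - 1)) = 9 - (3 * real M + 9) * (2 / 3) ^ M"
  proof (induction M)
    case (Suc M)
    have "(\<Sum>t\<in>{1..Suc M}. real t * (2 / 3) ^ (t - 1)) =
      (\<Sum>t\<in>{1..M}. real t * (2 / 3) ^ (t - 1)) + (real M + 1) * (2 / 3) ^ M" by simp
    also have "\<dots> = 9 - (3 * real (Suc M) + 9) * (2 / 3) ^ Suc M"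
      unfolding Suc.IH by (simp add: algebra_simps)
    finally show ?case .
  qed simp
  then show ?thesis by simp
qed

text \<open>Halasz's argument: frequency 0 contributes 1, frequencies of energy above
  \<open>M\<close> contribute at most 1 together, and the others are summed by energy layers whose
  sizes are bounded by sumset growth.\<close>

lemma rho_le_low_energy:
  assumes p: "prime p" and I: "finite I" and M: "M > 0"
    and ne: "low_energy p v I M \<noteq> {0..<int p}" and tail: "p * exp (- real M / 2) \<le> 1"
  shows "rho p v I * p \<le> 2 + 18 * card (low_energy p v I M) / sqrt M"
proof -
  let ?T = "low_energy p v I" and ?F = "energy p v I"
  have p0: "p > 0" using p prime_gt_0_nat by blast
  have sub: "?T t \<subseteq> {0..<int p}" for t by (auto simp: low_energy_def)
  have fin: "finite (?T t)" for t using finite_subset[OF sub] by blast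
  have 0: "0 \<in> ?T t" for t using p0 by (simp add: low_energy_def)
  have growth: "real (card (?T t - {0})) \<le> 2 * t / sqrt M * card (?T M)" if t: "t \<in> {1..M}" for t
  proof -
    \<comment> \<open>The largest \<open>j\<close> with \<open>j\<^sup>2 * t \<le> M\<close>, as
      sumset growth requires.\<close>
    define j where "j = nat \<lfloor>sqrt (M / t)\<rfloor>"
    have ge1: "sqrt (M / t) \<ge> 1" using t by simp
    then have j: "real j \<le> sqrt (M / t)" "sqrt (M / t) < real j + 1"
      unfolding j_def by linarith+
    have j1: "real j \<ge> 1" using ge1 unfolding j_def by (simp add: le_nat_iff le_floor_iff)
    have "(real j)\<^sup>2 \<le> (sqrt (M / t))\<^sup>2" using j by (intro power_mono) auto
    then have "real (j\<^sup>2 * t) \<le> M" using t by (simp add: field_simps)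
    then have "j\<^sup>2 * t \<le> M" by (simp only: of_nat_le_iff)
    from low_energy_growth[OF p this ne] have "j * card (?T t - {0}) \<le> card (?T M)"
      using fin 0 by simp
    then have "real j * card (?T t - {0}) \<le> card (?T M)"
      by (metis of_nat_le_iff of_nat_mult)
    \<comment> \<open>Rounding down costs a factor 2, as \<open>j \<ge> 1\<close>. Replacing
      \<open>sqrt t\<close> by \<open>t\<close> is harmless against the geometric decay in
      \<open>t\<close>.\<close>
    have "sqrt M \<le> 2 * real j * t"
    proof -
      have "sqrt M = sqrt (M / t) * sqrt t" using t by (simp flip: real_sqrt_mult)
      also have "\<dots> \<le> (2 * real j) * t"
      proof (rule mult_mono)
        show "sqrt t \<le> real t" using t by (intro real_le_lsqrt) (auto simp: power2_eq_square)
      qed (use j j1 in auto)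
      finally show ?thesis .
    qed
    then have "sqrt M * card (?T t - {0}) \<le> 2 * real j * t * card (?T t - {0})"
      by (intro mult_right_mono) auto
    also have "\<dots> = 2 * t * (real j * card (?T t - {0}))" by simp
    also have "\<dots> \<le> real (2 * t) * real (card (?T M))"
      by (intro mult_left_mono \<open>real j * card (?T t - {0}) \<le> card (?T M)\<close>) simp
    finally show ?thesis using M by (simp add: field_simps)
  qed
  define q where "q = exp (- (1 / 2) :: real)"
  have "3 / 2 \<le> exp (1 / 2 :: real)" using exp_ge_add_one_self[of "1 / 2 :: real"] by simp
  then have q: "0 \<le> q" "q \<le> 2 / 3" unfolding q_def by (simp_all add: exp_minus field_simps)
  have shell: "exp (- ?F k / 2) \<le> (\<Sum>t\<in>{1..M}. if ?F k \<le> t then q ^ (t - 1) else 0)"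
    if k: "k \<in> ?T M" for k
  proof -
    \<comment> \<open>The first layer containing \<open>k\<close>; the maximum with 1 handles energy
      0 and keeps \<open>t - 1\<close> a true subtraction.\<close>
    define t where "t = max 1 (nat \<lceil>?F k\<rceil>)"
    have F: "?F k \<le> M" "0 \<le> ?F k" using k energy_nonneg by (auto simp: low_energy_def)
    then have t: "t \<in> {1..M}" "?F k \<le> t" "real (t - 1) \<le> ?F k"
      using M unfolding t_def by (auto simp: max_def ceiling_le_iff nat_le_iff) linarith+
    have "exp (- ?F k / 2) \<le> exp (- real (t - 1) / 2)" using t by simp
    also have "\<dots> = q ^ (t - 1)" unfolding q_def by (simp flip: exp_of_nat_mult)
    also have "\<dots> = (if ?F k \<le> t then q ^ (t - 1) else 0)" using t by simp
    also have "\<dots> \<le> (\<Sum>t\<in>{1..M}. if ?F k \<le> t then q ^ (t - 1) else 0)"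
      by (rule member_le_sum[OF t(1)]) (use q in auto)
    finally show ?thesis .
  qed
  have "(\<Sum>k\<in>?T M - {0}. exp (- ?F k / 2)) \<le>
    (\<Sum>k\<in>?T M - {0}. \<Sum>t\<in>{1..M}. if ?F k \<le> t then q ^ (t - 1) else 0)"
    by (intro sum_mono shell) auto
  also have "\<dots> = (\<Sum>t\<in>{1..M}. \<Sum>k\<in>?T M - {0}. if ?F k \<le> t then q ^ (t - 1) else 0)"
    by (rule sum.swap)
  also have "\<dots> \<le> (\<Sum>t\<in>{1..M}. 2 * t / sqrt M * card (?T M) * (2 / 3) ^ (t - 1))"
  proof (rule sum_mono)
    fix t assume t: "t \<in> {1..M}"
    have "{k \<in> ?T M - {0}. ?F k \<le> t} = ?T t - {0}" using t by (auto simp: low_energy_def)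
    then have "(\<Sum>k\<in>?T M - {0}. if ?F k \<le> t then q ^ (t - 1) else 0) = card (?T t - {0}) * q ^ (t - 1)"
      using fin by (simp add: sum.If_cases Int_def)
    also have "\<dots> \<le> 2 * t / sqrt M * card (?T M) * (2 / 3) ^ (t - 1)"
    proof (rule mult_mono)
      show "real (card (?T t - {0})) \<le> 2 * t / sqrt M * card (?T M)" using growth[OF t] by simp
    qed (use q in \<open>auto intro: power_mono\<close>)
    finally show "(\<Sum>k\<in>?T M - {0}. if ?F k \<le> t then q ^ (t - 1) else 0) \<le>
      2 * t / sqrt M * card (?T M) * (2 / 3) ^ (t - 1)" .
  qed
  also have "\<dots> = 2 * card (?T M) / sqrt M * (\<Sum>t\<in>{1..M}. real t * (2 / 3) ^ (t - 1))"
    by (simp add: sum_distrib_left field_simps)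
  also have "\<dots> \<le> 2 * card (?T M) / sqrt M * 9"
    by (intro mult_left_mono sum_arith_geometric_le) simp
  finally have low: "(\<Sum>k\<in>?T M - {0}. exp (- ?F k / 2)) \<le> 18 * card (?T M) / sqrt M" by simp
  have "(\<Sum>k\<in>{0..<int p} - ?T M. exp (- ?F k / 2)) \<le> (\<Sum>k\<in>{0..<int p} - ?T M. exp (- real M / 2))"
    by (intro sum_mono) (auto simp: low_energy_def)
  also have "\<dots> \<le> (\<Sum>k\<in>{0..<int p}. exp (- real M / 2))" by (intro sum_mono2) auto
  also have "\<dots> \<le> 1" using tail by simp
  finally have high: "(\<Sum>k\<in>{0..<int p} - ?T M. exp (- ?F k / 2)) \<le> 1" .
  have "rho p v I * p \<le> (\<Sum>k\<in>{0..<int p}. exp (- ?F k / 2))"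
    by (rule rho_le_sum_exp_energy[OF p0 I])
  also have "\<dots> = (\<Sum>k\<in>{0..<int p} - ?T M. exp (- ?F k / 2)) + (\<Sum>k\<in>?T M. exp (- ?F k / 2))"
    by (rule sum.subset_diff[OF sub]) simp
  also have "(\<Sum>k\<in>?T M. exp (- ?F k / 2)) = 1 + (\<Sum>k\<in>?T M - {0}. exp (- ?F k / 2))"
    using sum.remove[OF fin 0, of "\<lambda>k. exp (- ?F k / 2)"] by simp
  finally show ?thesis using low high by linarith
qed

section \<open>Sampling and containers\<close>

text \<open>The exponential moment method in counting form: a bad pair of \<open>\<omega>\<close>
  and \<open>x\<close> has \<open>exp (a - G \<omega> x) \<ge> 1\<close>, so \<open>q\<close> bounds
  the failure probability of one \<open>x\<close>, and a union bound over \<open>X\<close>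
  finishes.\<close>

lemma exp_union_bound:
  fixes G :: "'a \<Rightarrow> 'b \<Rightarrow> real" and q :: real
  assumes fin: "finite \<Omega>" "\<Omega> \<noteq> {}" "finite X"
    and le: "\<And>x. x \<in> X \<Longrightarrow> (\<Sum>\<omega>\<in>\<Omega>. exp (a - G \<omega> x)) \<le> q * card \<Omega>"
    and q: "card X * q < 1"
  shows "\<exists>\<omega>\<in>\<Omega>. \<forall>x\<in>X. a < G \<omega> x"
proof (rule ccontr)
  assume "\<not> ?thesis"
  then have bad: "\<exists>x\<in>X. G \<omega> x \<le> a" if "\<omega> \<in> \<Omega>" for \<omega> using that by (auto simp: not_less)
  have "real (card \<Omega>) = (\<Sum>\<omega>\<in>\<Omega>. 1)" by simp
  also have "\<dots> \<le> (\<Sum>\<omega>\<in>\<Omega>. \<Sum>x\<in>X. exp (a - G \<omega> x))"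
  proof (rule sum_mono)
    fix \<omega> assume "\<omega> \<in> \<Omega>"
    then obtain x where x: "x \<in> X" "G \<omega> x \<le> a" using bad by blast
    then have "1 \<le> exp (a - G \<omega> x)" by simp
    also have "\<dots> \<le> (\<Sum>x\<in>X. exp (a - G \<omega> x))"
      by (rule member_le_sum[OF x(1)]) (auto simp: fin)
    finally show "1 \<le> (\<Sum>x\<in>X. exp (a - G \<omega> x))" .
  qed
  also have "\<dots> = (\<Sum>x\<in>X. \<Sum>\<omega>\<in>\<Omega>. exp (a - G \<omega> x))" by (rule sum.swap)
  also have "\<dots> \<le> (\<Sum>x\<in>X. q * card \<Omega>)" by (intro sum_mono le)
  also have "\<dots> = (card X * q) * card \<Omega>" by simp
  also have "\<dots> < 1 * real (card \<Omega>)"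
    using fin by (intro mult_strict_right_mono q) (simp add: card_gt_0_iff)
  finally show False by simp
qed

text \<open>On the unit interval \<open>(1 + y) * (1 - y / 2) \<ge> 1\<close>, and
  \<open>1 + y \<le> exp y\<close>.\<close>

lemma exp_minus_le:
  assumes "0 \<le> y" "y \<le> (1::real)" shows "exp (- y) \<le> 1 - y / 2"
proof -
  have "y * y \<le> y * 1" using assms by (intro mult_left_mono)
  then have "1 \<le> (1 + y) * (1 - y / 2)" by (simp add: field_simps)
  also have "\<dots> \<le> exp y * (1 - y / 2)"
    using assms by (intro mult_right_mono exp_ge_add_one_self) auto
  finally show ?thesis by (simp add: exp_minus field_simps)
qed

text \<open>Choosing one element from each pair $\{j, h + j\}$ makes the size of the sample deterministic.\<close>

lemma ex_half_sample:
  fixes w :: "'b \<Rightarrow> nat \<Rightarrow> real"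
  assumes K: "finite K" and w: "\<And>k i. 0 \<le> w k i" "\<And>k i. w k i \<le> 1"
    and L: "\<And>k. k \<in> K \<Longrightarrow> L \<le> (\<Sum>i\<in>{0..<n}. w k i)"
    and small: "card K * exp (a - (L - 1) / 4) < 1"
  shows "\<exists>Y. Y \<subseteq> {0..<n} \<and> card Y = n div 2 \<and> (\<forall>k\<in>K. a < (\<Sum>i\<in>Y. w k i))"
proof -
  define h where "h = n div 2"
  \<comment> \<open>\<open>A\<close> records the pairs from which the lower element \<open>j\<close>
    is taken; the other pairs give \<open>h + j\<close>.\<close>
  define G where "G A k = (\<Sum>j\<in>A. w k j) + (\<Sum>j\<in>{..<h} - A. w k (h + j))" for A k
  have "\<exists>A\<in>Pow {..<h}. \<forall>k\<in>K. a < G A k"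
  proof (rule exp_union_bound)
    fix k assume k: "k \<in> K"
    have "(\<Sum>A\<in>Pow {..<h}. exp (a - G A k)) =
      exp a * (\<Sum>A\<in>Pow {..<h}. (\<Prod>j\<in>A. exp (- w k j)) * (\<Prod>j\<in>{..<h} - A. exp (- w k (h + j))))"
      unfolding sum_distrib_left
    proof (rule sum.cong[OF refl])
      fix A assume "A \<in> Pow {..<h}"
      then have "finite A" using finite_subset by blast
      then show "exp (a - G A k) = exp a * ((\<Prod>j\<in>A. exp (- w k j)) * (\<Prod>j\<in>{..<h} - A. exp (- w k (h + j))))"
        by (simp add: G_def sum_negf flip: exp_sum exp_add)
    qed
    \<comment> \<open>The choices in different pairs are independent: expanding the product gives
      one term for each \<open>A\<close>.\<close>
    also have "\<dots> = exp a * (\<Prod>j<h. exp (- w k j) + exp (- w k (h + j)))"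
      by (subst prod_add) simp_all
    also have "\<dots> \<le> exp a * (\<Prod>j<h. 2 * exp (- (w k j + w k (h + j)) / 4))"
    proof (intro mult_left_mono prod_mono, safe)
      fix j
      have "exp (- w k j) + exp (- w k (h + j)) \<le> 2 * (1 + - (w k j + w k (h + j)) / 4)"
        using exp_minus_le[OF w, of k j] exp_minus_le[OF w, of k "h + j"] by (simp add: field_simps)
      also have "\<dots> \<le> 2 * exp (- (w k j + w k (h + j)) / 4)"
        by (intro mult_left_mono exp_ge_add_one_self) simp
      finally show "exp (- w k j) + exp (- w k (h + j)) \<le> 2 * exp (- (w k j + w k (h + j)) / 4)" .
    qed (auto intro: add_nonneg_nonneg)
    also have "\<dots> = exp (a - (\<Sum>j<h. w k j + w k (h + j)) / 4) * 2 ^ h"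
    proof -
      have "(\<Prod>j<h. 2 * exp (- (w k j + w k (h + j)) / 4)) =
        2 ^ h * exp (\<Sum>j<h. - (w k j + w k (h + j)) / 4)"
        by (simp add: prod.distrib exp_sum)
      also have "(\<Sum>j<h. - (w k j + w k (h + j)) / 4) = - (\<Sum>j<h. w k j + w k (h + j)) / 4"
        by (simp only: sum_negf sum_divide_distrib[symmetric])
      finally have prod: "(\<Prod>j<h. 2 * exp (- (w k j + w k (h + j)) / 4)) =
        2 ^ h * exp (- (\<Sum>j<h. w k j + w k (h + j)) / 4)" .
      have "exp (a - (\<Sum>j<h. w k j + w k (h + j)) / 4) =
        exp a * exp (- (\<Sum>j<h. w k j + w k (h + j)) / 4)"
        by (simp flip: exp_add)
      then show ?thesis unfolding prod by (simp only: mult_ac)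
    qed
    also have "\<dots> \<le> exp (a - (L - 1) / 4) * 2 ^ h"
    proof -
      have split: "(\<Sum>j<h. w k j + w k (h + j)) = (\<Sum>i\<in>{0..<2 * h}. w k i)"
        using sum.atLeastLessThan_concat[of 0 h "2 * h" "w k"] sum.shift_bounds_nat_ivl[of "w k" 0 h h]
        by (simp add: sum.distrib add.commute mult_2 atLeast0LessThan)
      \<comment> \<open>For odd \<open>n\<close> the last coordinate is in no pair. Its weight is at
        most 1, which explains the \<open>L - 1\<close>.\<close>
      have "n = 2 * h \<or> n = Suc (2 * h)" by (auto simp: h_def)
      then have "(\<Sum>i\<in>{0..<n}. w k i) \<le> (\<Sum>i\<in>{0..<2 * h}. w k i) + 1"
        using w(2)[of k "2 * h"] by auto
      with L[OF k] split show ?thesis by simp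
    qed
    finally show "(\<Sum>A\<in>Pow {..<h}. exp (a - G A k)) \<le> exp (a - (L - 1) / 4) * card (Pow {..<h})"
      by (simp add: card_Pow)
  qed (use K small in auto)
  then obtain A where A: "A \<subseteq> {..<h}" "\<And>k. k \<in> K \<Longrightarrow> a < G A k" by auto
  define Y where "Y = A \<union> (+) h ` ({..<h} - A)"
  have finA: "finite A" using A(1) finite_subset by blast
  have disj: "A \<inter> (+) h ` ({..<h} - A) = {}" using A(1) by auto
  have "Y \<subseteq> {0..<n}" using A(1) by (force simp: Y_def h_def)
  moreover have "card Y = n div 2"
  proof -
    have "card Y = card A + card ({..<h} - A)"
      unfolding Y_def using finA disj by (simp add: card_Un_disjoint card_image)
    also have "\<dots> = h" using finA A(1) card_mono[OF _ A(1)] by (simp add: card_Diff_subset)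
    finally show ?thesis by (simp add: h_def)
  qed
  moreover have "(\<Sum>i\<in>Y. w k i) = G A k" for k
    unfolding Y_def G_def using finA disj by (subst sum.union_disjoint) (auto simp: sum.reindex)
  ultimately show ?thesis using A(2) by auto
qed

text \<open>Chernoff bound for \<open>m\<close> independent uniform draws from \<open>T\<close>. A
  mean above 1/4 makes the average of \<open>exp (- g)\<close> at most \<open>exp (- 1/8)\<close>;
  the threshold \<open>m / 16\<close> gives back half of this exponent.\<close>

lemma ex_sample_tuple:
  fixes g :: "'x \<Rightarrow> 'k \<Rightarrow> real"
  assumes T: "finite T" "T \<noteq> {}" and X: "finite X"
    and g: "\<And>x k. 0 \<le> g x k" "\<And>x k. g x k \<le> 1"
    and avg: "\<And>x. x \<in> X \<Longrightarrow> card T / 4 < (\<Sum>k\<in>T. g x k)"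
    and small: "card X * exp (- real m / 16) < 1"
  shows "\<exists>U \<in> {..<m} \<rightarrow>\<^sub>E T. \<forall>x\<in>X. real m / 16 < (\<Sum>j<m. g x (U j))"
proof (rule exp_union_bound[OF _ _ X _ small])
  show "finite ({..<m} \<rightarrow>\<^sub>E T)" using T by (simp add: finite_PiE)
  show "{..<m} \<rightarrow>\<^sub>E T \<noteq> {}" using T by (simp add: PiE_eq_empty_iff)
  fix x assume x: "x \<in> X"
  have "(\<Sum>U\<in>{..<m} \<rightarrow>\<^sub>E T. exp (real m / 16 - (\<Sum>j<m. g x (U j)))) =
    exp (real m / 16) * (\<Sum>U\<in>{..<m} \<rightarrow>\<^sub>E T. \<Prod>j<m. exp (- g x (U j)))"
    by (simp add: sum_distrib_left sum_negf flip: exp_sum exp_add)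
  also have "\<dots> = exp (real m / 16) * (\<Sum>k\<in>T. exp (- g x k)) ^ m"
    using prod_sum_PiE[of "{..<m}" "\<lambda>_. T" "\<lambda>_ k. exp (- g x k)"] T by simp
  also have "\<dots> \<le> exp (real m / 16) * (card T * exp (- (1 / 8))) ^ m"
  proof (intro mult_left_mono power_mono)
    have "(\<Sum>k\<in>T. exp (- g x k)) \<le> (\<Sum>k\<in>T. 1 - g x k / 2)"
      by (intro sum_mono exp_minus_le g)
    also have "\<dots> \<le> card T * (1 + - (1 / 8))"
      using avg[OF x] by (simp add: sum_subtractf flip: sum_divide_distrib)
    also have "\<dots> \<le> card T * exp (- (1 / 8))"
      by (intro mult_left_mono exp_ge_add_one_self) simp
    finally show "(\<Sum>k\<in>T. exp (- g x k)) \<le> card T * exp (- (1 / 8))" .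
  qed (auto intro: sum_nonneg)
  also have "\<dots> = exp (real m / 16) * exp (- real m / 8) * card ({..<m} \<rightarrow>\<^sub>E T)"
    by (simp add: power_mult_distrib card_PiE flip: exp_of_nat_mult)
  also have "\<dots> = exp (- real m / 16) * card ({..<m} \<rightarrow>\<^sub>E T)"
    by (simp flip: exp_add)
  finally show "(\<Sum>U\<in>{..<m} \<rightarrow>\<^sub>E T. exp (real m / 16 - (\<Sum>j<m. g x (U j)))) \<le>
    exp (- real m / 16) * card ({..<m} \<rightarrow>\<^sub>E T)" .
qed

text \<open>Only \<open>m\<close> frequencies enter, not \<open>n\<close> or \<open>v\<close>, so
  tuples of residues yield at most \<open>p ^ m\<close> containers.\<close>

definition container :: "nat \<Rightarrow> nat \<Rightarrow> (nat \<Rightarrow> int) \<Rightarrow> int set" where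
  "container p m U = {x \<in> {0..<int p}. (\<Sum>j<m. wt p (U j) x) \<le> real m / 16}"

text \<open>Double counting: each index outside contributes more than \<open>m / 16\<close> to the
  sum of the \<open>m\<close> energies, which is at most \<open>m * L\<close>.\<close>

lemma card_outside_container:
  fixes L :: real
  assumes m: "m > 0" and U: "\<And>j. j < m \<Longrightarrow> energy p v {0..<n} (U j) \<le> L"
    and v: "\<And>i. i < n \<Longrightarrow> v i \<in> {0..<int p}"
  shows "card {i \<in> {0..<n}. v i \<notin> container p m U} \<le> 16 * L"
proof -
  let ?O = "{i \<in> {0..<n}. v i \<notin> container p m U}"
  have "card ?O * (real m / 16) = (\<Sum>i\<in>?O. real m / 16)" by simp
  also have "\<dots> \<le> (\<Sum>i\<in>?O. \<Sum>j<m. wt p (U j) (v i))"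
    using v by (intro sum_mono) (auto simp: container_def)
  also have "\<dots> \<le> (\<Sum>i\<in>{0..<n}. \<Sum>j<m. wt p (U j) (v i))"
    by (intro sum_mono2) (auto intro: sum_nonneg wt_nonneg)
  also have "\<dots> = (\<Sum>j<m. energy p v {0..<n} (U j))" unfolding energy_def by (rule sum.swap)
  also have "\<dots> \<le> (\<Sum>j<m. L)" using U by (intro sum_mono) auto
  finally show ?thesis using m by (simp add: field_simps)
qed

text \<open>Some tuple from \<open>T\<close> excludes every residue whose average weight over
  \<open>T\<close> exceeds 1/4, by a union bound over at most \<open>p\<close> residues. Parseval's
  identity bounds what remains.\<close>

lemma ex_small_container:
  assumes p: "prime p" "p > 2" and T: "T \<subseteq> {0..<int p}" "T \<noteq> {}"
    and m: "p * exp (- real m / 16) < 1"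
  shows "\<exists>U \<in> {..<m} \<rightarrow>\<^sub>E T. card (container p m U) * card T \<le> 4 * p"
proof -
  define S where "S = {x \<in> {0..<int p}. (\<Sum>k\<in>T. wt p k x) \<le> card T / 4}"
  have "card ({0..<int p} - S) * exp (- real m / 16) \<le> p * exp (- real m / 16)"
    using card_mono[of "{0..<int p}" "{0..<int p} - S"] by (intro mult_right_mono) auto
  then have "\<exists>U \<in> {..<m} \<rightarrow>\<^sub>E T. \<forall>x\<in>{0..<int p} - S. real m / 16 < (\<Sum>j<m. wt p (U j) x)"
    using m T finite_subset[OF T(1)]
    by (intro ex_sample_tuple[where g = "\<lambda>x k. wt p k x"] le_less_trans[OF _ m])
      (auto simp: S_def wt_nonneg wt_le_1 not_le)
  then obtain U where U: "U \<in> {..<m} \<rightarrow>\<^sub>E T" "\<forall>x\<in>{0..<int p} - S. real m / 16 < (\<Sum>j<m. wt p (U j) x)"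
    by blast
  have "container p m U \<subseteq> S" using U(2) by (force simp: container_def)
  then have "card (container p m U) * card T \<le> card S * card T"
    by (intro mult_right_mono card_mono) (auto simp: S_def intro: finite_subset[of _ "{0..<int p}"])
  also have "\<dots> \<le> 4 * p" unfolding S_def by (rule few_low_average[OF p T(1)])
  finally show ?thesis using U(1) by blast
qed

theorem theorem1p2:
  fixes p :: nat
  assumes "prime p"
  shows "\<exists>C :: int set set.
    C \<subseteq> Pow {0..<int p} \<and>
    real (card C) \<le> exp (2 ^ 12 * (ln (real p)) ^ 2) \<and>
    (\<forall>(n::nat) (v :: nat \<Rightarrow> int).
       (\<forall>i<n. v i \<in> {0..<int p}) \<and>
       rho p v {0..<n} \<ge> 4 / real p \<and>
       real (supp_size n v) \<ge> 2 ^ 18 * ln (real p)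
       \<longrightarrow>
       (\<exists>B\<in>C. \<exists>Y. Y \<subseteq> {0..<n} \<and>
          real n / 4 \<le> real (card Y) \<and> real (card Y) \<le> real n / 2 \<and>
          real (card {i \<in> {0..<n}. v i \<notin> B}) \<le> real n / 4 \<and>
          real (card B) \<le> 2 ^ 16 / (rho p v Y * sqrt (real (supp_size n v)))))"
proof -
  have p0: "p > 0" using assms prime_gt_0_nat by blast
  \<comment> \<open>As large as the bound on the family allows, since
    \<open>p ^ m = exp (m * ln p)\<close>; the Chernoff bound needs only
    \<open>m > 16 * ln p\<close>.\<close>
  define m where "m = nat \<lfloor>2 ^ 12 * ln (real p)\<rfloor>"
  define C where "C = container p m ` ({..<m} \<rightarrow>\<^sub>E {0..<int p})"
  have "card C \<le> card ({..<m} \<rightarrow>\<^sub>E {0..<int p})"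
    unfolding C_def by (intro card_image_le finite_PiE) auto
  then have "real (card C) \<le> real (p ^ m)" by (simp add: card_PiE)
  also have "\<dots> = exp (real m * ln p)"
    using p0 by (simp add: exp_of_nat_mult)
  also have "\<dots> \<le> exp (2 ^ 12 * (ln p)\<^sup>2)"
  proof -
    have "ln (real p) \<ge> 0" using p0 by simp
    then have "real m * ln p \<le> (2 ^ 12 * ln p) * ln p"
      unfolding m_def by (intro mult_right_mono of_nat_floor) auto
    then show ?thesis by (simp add: power2_eq_square)
  qed
  finally have card_C: "real (card C) \<le> exp (2 ^ 12 * (ln p)\<^sup>2)" .
  have "\<exists>B\<in>C. \<exists>Y. Y \<subseteq> {0..<n} \<and>
      real n / 4 \<le> real (card Y) \<and> real (card Y) \<le> real n / 2 \<and>
      real (card {i \<in> {0..<n}. v i \<notin> B}) \<le> real n / 4 \<and>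
      real (card B) \<le> 2 ^ 16 / (rho p v Y * sqrt (real (supp_size n v)))"
    if v: "\<forall>i<n. v i \<in> {0..<int p}" and rho: "rho p v {0..<n} \<ge> 4 / real p"
      and supp: "real (supp_size n v) \<ge> 2 ^ 18 * ln (real p)" for n v
  proof -
    define N where "N = supp_size n v"
    \<comment> \<open>Small enough for the half sample to keep large energies above
      \<open>M\<close>, yet at least \<open>N / 1024\<close> after rounding.\<close>
    define M where "M = N div 512"
    \<comment> \<open>A probability is at most 1, so the hypothesis on \<open>rho\<close> rules out
      \<open>p = 2\<close> and \<open>p = 3\<close>.\<close>
    have "4 / real p \<le> 1" using rho rho_le_1[OF p0, of "{0..<n}" v] by simp
    then have p4: "p \<ge> 4" using p0 by simp
    then have p2: "p > 2" by simp
    have "exp 1 \<le> real p" using exp_le p4 by linarith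
    then have lnp: "ln (real p) \<ge> 1" using p0 by (simp add: ln_ge_iff)
    have N: "real N \<ge> 262144 * ln (real p)" using supp by (simp add: N_def)
    have "N \<le> card {0..<n}" unfolding N_def supp_size_def by (intro card_mono) auto
    then have Nn: "N \<le> n" by simp
    have M_le: "real M \<le> N / 512"
    proof -
      have "512 * M \<le> N" unfolding M_def by simp
      then show ?thesis by linarith
    qed
    have M_ge: "real M \<ge> N / 1024"
    proof -
      have "N \<ge> 1024" using N lnp by linarith
      then have "N \<le> 1024 * M" unfolding M_def by linarith
      then show ?thesis by linarith
    qed
    have M0: "M > 0" using M_ge N lnp by (intro Nat.gr0I) simp
    define F where "F = energy p v {0..<n}"
    \<comment> \<open>Frequencies that must stay out of the level set of \<open>Y\<close>: the
      cutoff \<open>N / 64\<close> later becomes \<open>16 * (N / 64) = N / 4\<close> exceptional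
      coordinates.\<close>
    define K where "K = {k \<in> {0..<int p}. N / 64 < F k}"
    have K: "K \<subseteq> {0..<int p}" by (auto simp: K_def)
    have "card K \<le> p" using card_mono[OF _ K] by simp
    then have "card K * exp (real M - (N / 64 - 1) / 4) \<le> exp (ln p) * exp (real M - (N / 64 - 1) / 4)"
      using p0 by (intro mult_right_mono) auto
    also have "\<dots> = exp (ln p + (real M - (N / 64 - 1) / 4))" by (rule exp_add[symmetric])
    \<comment> \<open>The exponent is at most \<open>ln p + 1 / 4 - N / 512\<close>, and
      \<open>N / 512 \<ge> 512 * ln p\<close>.\<close>
    also have "ln (real p) + (real M - (N / 64 - 1) / 4) < 0"
      using M_le N lnp by (simp add: field_simps)
    finally have "card K * exp (real M - (N / 64 - 1) / 4) < 1" by simp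
    then have "\<exists>Y. Y \<subseteq> {0..<n} \<and> card Y = n div 2 \<and> (\<forall>k\<in>K. real M < (\<Sum>i\<in>Y. wt p k (v i)))"
    proof (intro ex_half_sample[where L = "N / 64"])
      show "finite K" using K finite_subset by blast
    qed (auto simp: wt_nonneg wt_le_1 K_def F_def energy_def)
    then obtain Y where Y: "Y \<subseteq> {0..<n}" "card Y = n div 2" "\<And>k. k \<in> K \<Longrightarrow> M < energy p v Y k"
      by (auto simp: energy_def)
    have finY: "finite Y" using Y(1) finite_subset by blast
    define T where "T = low_energy p v Y M"
    have T: "T \<subseteq> {0..<int p}" "0 \<in> T" using p0 by (auto simp: T_def low_energy_def)
    have F_T: "F k \<le> N / 64" if "k \<in> T" for k
      using that Y(3)[of k] by (force simp: K_def T_def low_energy_def)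
    \<comment> \<open>A frequency of energy \<open>N / 2 > N / 64\<close> witnesses that
      \<open>T\<close> is proper, as the growth estimate requires.\<close>
    obtain k0 where k0: "k0 \<in> {0..<int p}" "N / 2 \<le> F k0"
      using large_energy[OF assms p2, of n v] v by (auto simp: N_def F_def)
    have "k0 \<notin> T" using F_T[of k0] k0(2) N lnp by force
    then have T_ne: "low_energy p v Y M \<noteq> {0..<int p}" using k0(1) by (auto simp: T_def)
    have m_ge: "real m \<ge> 2048 * ln (real p)"
    proof -
      have "real m + 1 > 4096 * ln (real p)" unfolding m_def using lnp by simp
      then show ?thesis using lnp by linarith
    qed
    have "real p * exp (- real m / 16) = exp (ln p + - real m / 16)"
      unfolding exp_add using p0 by simp
    also have "\<dots> < exp 0" using m_ge lnp by (subst exp_less_cancel_iff) simp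
    finally obtain U where U: "U \<in> {..<m} \<rightarrow>\<^sub>E T" "card (container p m U) * card T \<le> 4 * p"
      using ex_small_container[OF assms p2 T(1), of m] T(2) by auto
    let ?B = "container p m U"
    have "m > 0" using m_ge lnp by (intro Nat.gr0I) simp
    have "U \<in> {..<m} \<rightarrow>\<^sub>E {0..<int p}" using U(1) T(1) by (rule subsetD[OF PiE_mono, rotated])
    then have "?B \<in> C" by (simp add: C_def)
    moreover have "real n / 4 \<le> real (card Y)" "real (card Y) \<le> real n / 2"
    proof -
      \<comment> \<open>Needed for \<open>n div 2 \<ge> n / 4\<close>, which fails at
        \<open>n = 1\<close>.\<close>
      have "n \<ge> 2" using N lnp Nn by linarith
      then show "real n / 4 \<le> real (card Y)" "real (card Y) \<le> real n / 2"
        unfolding Y(2) by linarith+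
    qed
    moreover have "real (card {i \<in> {0..<n}. v i \<notin> ?B}) \<le> real n / 4"
    proof -
      have "real (card {i \<in> {0..<n}. v i \<notin> ?B}) \<le> 16 * (N / 64)"
        using v U(1) F_T by (intro card_outside_container[OF \<open>m > 0\<close>]) (auto simp: F_def)
      then show ?thesis using Nn by simp
    qed
    moreover have "real (card ?B) \<le> 2 ^ 16 / (rho p v Y * sqrt N)"
    proof -
      have rho_Y: "rho p v Y * p \<ge> 4"
      proof -
        have "4 / real p \<le> rho p v Y" using rho_antimono[OF p0 _ Y(1), of v] rho by simp
        then show ?thesis using p0 by (simp add: field_simps)
      qed
      have "real p * exp (- real M / 2) = exp (ln p + - real M / 2)"
        unfolding exp_add using p0 by simp
      also have "\<dots> \<le> exp 0" using M_ge N lnp by (subst exp_le_cancel_iff) simp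
      finally have "rho p v Y * p \<le> 2 + 18 * card T / sqrt M"
        using rho_le_low_energy[OF assms finY M0 T_ne] by (simp add: T_def)
      \<comment> \<open>The additive 2 is at most half of \<open>rho p v Y * p \<ge> 4\<close>;
        absorbing it doubles the constant 18.\<close>
      with rho_Y have "rho p v Y * p \<le> 36 * card T / sqrt M" by simp
      then have "rho p v Y * p * sqrt M \<le> 36 * card T" using M0 by (simp add: field_simps)
      \<comment> \<open>From \<open>N \<le> 1024 * M\<close>. The constants multiply to
        \<open>36 * 32 = 1152\<close>, and the container bound \<open>4 * p\<close> gives
        \<open>4608 < 2 ^ 16\<close>.\<close>
      moreover have "sqrt N \<le> 32 * sqrt M"
        using M_ge by (intro real_le_lsqrt) (auto simp: power_mult_distrib)
      then have "rho p v Y * p * sqrt N \<le> rho p v Y * p * (32 * sqrt M)"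
        using rho_Y by (intro mult_left_mono) auto
      ultimately have "rho p v Y * p * sqrt N \<le> 1152 * card T" by simp
      then have "card ?B * (rho p v Y * p * sqrt N) \<le> real (card ?B) * real (1152 * card T)"
        by (intro mult_left_mono) auto
      also have "\<dots> = 1152 * real (card ?B * card T)" by simp
      also have "\<dots> \<le> 1152 * real (4 * p)" using U(2) by (intro mult_left_mono of_nat_mono) auto
      finally have "p * (card ?B * (rho p v Y * sqrt N)) \<le> p * 4608" by (simp add: mult_ac)
      then have "card ?B * (rho p v Y * sqrt N) \<le> 4608" using p0 by simp
      moreover have "rho p v Y * sqrt N > 0"
      proof (rule mult_pos_pos)
        have "0 < rho p v Y * p" using rho_Y by linarith
        then show "rho p v Y > 0" by (simp add: zero_less_mult_iff)
        show "sqrt N > 0" using N lnp by simp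
      qed
      ultimately show ?thesis by (simp add: pos_le_divide_eq)
    qed
    ultimately show ?thesis using Y(1) unfolding N_def by blast
  qed
  moreover have "C \<subseteq> Pow {0..<int p}" by (auto simp: C_def container_def)
  ultimately show ?thesis using card_C by blast
qed

end
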